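(* For every odd integer $k \ge 3$ there exists a finite graph $G$ such that the magnitude homology group $\mathrm{MH}_{k,k+1}(G)$ contains a subgroup isomorphic to $\mathbb{Z}_2$.
   Context: All graphs are finite, undirected, with no loops and no multiple edges. For a graph $G$, $d(x,y)$ denotes the shortest-path distance between vertices $x,y$ (each edge has length $1$; $d(x,y)=\infty$ if there is no path). A $k$-path is a $(k+1)$-tuple $(x_0,\dots,x_k)$ of vertices with $x_i\neq x_{i+1}$ and $d(x_i,x_{i+1})<\infty$ for $0\le i\le k-1$; its length is $\ell(x_0,\dots,x_k)=\sum_{i=0}^{k-1} d(x_i,x_{i+1})$. Let $\mathrm{MC}_{k,\ell}(G)$ be the free abelian group on all $k$-paths of length $\ell$. For $1\le i\le k-1$ let $\partial_i:\mathrm{MC}_{k,\ell}(G)\to \mathrm{MC}_{k-1,\ell}(G)$ send $(x_0,\dots,x_k)$ to $(x_0,\dots,x_{i-1},x_{i+1},\dots,x_k)$ if this tuple is a $(k-1)$-path of length $\ell$, and to $0$ otherwise; set $\partial=\sum_{i=1}^{k-1}(-1)^i\partial_i$. Then $(\mathrm{MC}_{*,\ell}(G),\partial)$ is a chain complex for each $\ell$, and the magnitude homology is $\mathrm{MH}_{k,\ell}(G)=H_k(\mathrm{MC}_{*,\ell}(G))$. *)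

theory Defs
  imports
    "HOL-Algebra.Algebra"
    "Graph_Theory.Graph_Theory"
begin

text \<open>
  Finite simple graphs are the locale \<^locale>\<open>pair_graph\<close>: finite, symmetric, loop-free
  digraphs whose arcs are pairs of vertices, an edge \<open>{x, y}\<close> being the two arcs \<open>(x, y)\<close> and
  \<open>(y, x)\<close>. The distance is the library's infimum of the costs of all walks for unit weights;
  it is \<open>\<infinity>\<close> if there is no walk.
\<close>

definition gdist :: "'a pair_pre_digraph \<Rightarrow> 'a \<Rightarrow> 'a \<Rightarrow> ereal" where
  "gdist G x y = wf_digraph.\<mu> (with_proj G) (\<lambda>_. 1) x y"

text \<open>A tuple \<open>(x\<^sub>0, \<dots>, x\<^sub>k)\<close> is the list of its \<open>k + 1\<close> entries.\<close>

definition k_paths :: "'a pair_pre_digraph \<Rightarrow> nat \<Rightarrow> 'a list set" where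
  "k_paths G k = {xs. length xs = k + 1 \<and> set xs \<subseteq> pverts G \<and>
     (\<forall>i<k. xs ! i \<noteq> xs ! (i + 1) \<and> gdist G (xs ! i) (xs ! (i + 1)) < \<infinity>)}"

definition path_length :: "'a pair_pre_digraph \<Rightarrow> 'a list \<Rightarrow> ereal" where
  "path_length G xs = (\<Sum>i<length xs - 1. gdist G (xs ! i) (xs ! (i + 1)))"

definition k_paths_of_length :: "'a pair_pre_digraph \<Rightarrow> nat \<Rightarrow> nat \<Rightarrow> 'a list set" where
  "k_paths_of_length G k l = {xs \<in> k_paths G k. path_length G xs = ereal (real l)}"

definition MC :: "'a pair_pre_digraph \<Rightarrow> nat \<Rightarrow> nat \<Rightarrow> ('a list \<Rightarrow>\<^sub>0 int) monoid" where
  "MC G k l = free_Abelian_group (k_paths_of_length G k l)"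

definition delete_nth :: "nat \<Rightarrow> 'a list \<Rightarrow> 'a list" where
  "delete_nth i xs = take i xs @ drop (i + 1) xs"

definition face ::
  "'a pair_pre_digraph \<Rightarrow> nat \<Rightarrow> nat \<Rightarrow> nat \<Rightarrow> ('a list \<Rightarrow>\<^sub>0 int) \<Rightarrow> ('a list \<Rightarrow>\<^sub>0 int)" where
  "face G k l i = frag_extend (\<lambda>xs.
     if delete_nth i xs \<in> k_paths_of_length G (k - 1) l then frag_of (delete_nth i xs) else 0)"

text \<open>
  The differential \<open>MC G k l \<rightarrow> MC G (k - 1) l\<close>. For \<open>k \<le> 1\<close> the sum is empty and the differential
  is zero, so the truncated \<open>k - 1\<close> at \<open>k = 0\<close> is harmless.
\<close>

definition boundary ::
  "'a pair_pre_digraph \<Rightarrow> nat \<Rightarrow> nat \<Rightarrow> ('a list \<Rightarrow>\<^sub>0 int) \<Rightarrow> ('a list \<Rightarrow>\<^sub>0 int)" where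
  "boundary G k l c = (\<Sum>i\<in>{1..<k}. frag_cmul ((- 1) ^ i) (face G k l i c))"

definition magnitude_homology ::
  "'a pair_pre_digraph \<Rightarrow> nat \<Rightarrow> nat \<Rightarrow> ('a list \<Rightarrow>\<^sub>0 int) set monoid" where
  "magnitude_homology G k l =
     (MC G k l)\<lparr>carrier := kernel (MC G k l) (MC G (k - 1) l) (boundary G k l)\<rparr>
     Mod (boundary G (k + 1) l ` carrier (MC G (k + 1) l))"

end

theory Submission
  imports Defs
begin

text \<open>
  A walk of \<open>k + 1\<close> edges between the bottom and the top of a graded graph of rank \<open>k + 1\<close> is a
  maximal chain, and the magnitude complex between these two vertices is the shifted chain complex
  of the order complex of the graph. If every interval of length two has exactly two midpoints,
  neighbouring maximal chains enter the boundary with equal signs, since the sign depends only on the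
  deleted rank. So the sum of all maximal chains has boundary \<open>2 c\<close>, and \<open>c\<close> represents a class of
  order two unless the adjacency graph of the maximal chains is bipartite. For the face poset of the
  projective plane it is not bipartite, and this survives suspension, which raises \<open>k\<close> by one.
\<close>

section \<open>Distances and path lengths\<close>

lemma (in pair_graph) gdist_less_infinity_iff: "gdist G x y < \<infinity> \<longleftrightarrow> x \<rightarrow>\<^sup>*\<^bsub>with_proj G\<^esub> y"
  using \<mu>_reach_conv unfolding gdist_def .

lemma (in pair_graph) gdist_le_length: "awalk x p y \<Longrightarrow> gdist G x y \<le> ereal (length p)"
  using min_cost_le_walk_cost[of x p y "\<lambda>_. 1"]
  by (simp add: gdist_def awalk_cost_def sum_list_triv)

lemma (in pair_graph) gdist_attained:
  assumes "gdist G x y < \<infinity>"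
  obtains p where "awalk x p y" "gdist G x y = ereal (length p)"
proof -
  obtain p where "apath x p y" "\<mu> (\<lambda>_. 1) x y = awalk_cost (\<lambda>_. 1) p"
    using min_cost_awalk[of x y "\<lambda>_. 1"] assms unfolding gdist_less_infinity_iff by auto
  then have "awalk x p y" "gdist G x y = ereal (length p)"
    by (auto simp: gdist_def awalk_cost_def sum_list_triv apath_def)
  then show ?thesis by (rule that)
qed

lemma (in pair_graph) gdist_nonneg: "0 \<le> gdist G x y"
proof (cases "gdist G x y < \<infinity>")
  case True
  then show ?thesis by (rule gdist_attained) simp
qed auto

lemma (in pair_graph) gdist_self: "x \<in> pverts G \<Longrightarrow> gdist G x x = 0"
  using gdist_le_length[of x "[]" x] gdist_nonneg[of x x]
  by (simp add: awalk_Nil_iff zero_ereal_def)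

lemma (in pair_graph) gdist_ge_1:
  assumes "x \<noteq> y"
  shows "1 \<le> gdist G x y"
proof (cases "gdist G x y < \<infinity>")
  case True
  then obtain p where p: "awalk x p y" "gdist G x y = ereal (length p)"
    by (rule gdist_attained)
  then have "p \<noteq> []" using assms by (auto simp: awalk_Nil_iff)
  then show ?thesis using p(2) by (cases p) auto
qed auto

lemma (in pair_graph) gdist_triangle: "gdist G x z \<le> gdist G x y + gdist G y z"
proof (cases "gdist G x y < \<infinity> \<and> gdist G y z < \<infinity>")
  case True
  then obtain p q where "awalk x p y" "gdist G x y = ereal (length p)"
      "awalk y q z" "gdist G y z = ereal (length q)"
    by (metis gdist_attained)
  then show ?thesis
    using gdist_le_length[OF awalk_appendI[of x p y q z]] by simp
next
  case False
  then show ?thesis using gdist_nonneg[of x y] gdist_nonneg[of y z] by auto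
qed

lemma (in pair_graph) gdist_eq_1_iff: "gdist G x y = 1 \<longleftrightarrow> (x, y) \<in> parcs G"
proof
  assume eq: "gdist G x y = 1"
  then obtain p where p: "awalk x p y" "gdist G x y = ereal (length p)"
    using gdist_attained[of x y] by (auto simp: one_ereal_def)
  then obtain e where "p = [e]" using eq
    by (auto simp: one_ereal_def length_Suc_conv)
  with p(1) show "(x, y) \<in> parcs G" by (auto simp: awalk_Cons_iff awalk_Nil_iff)
next
  assume xy: "(x, y) \<in> parcs G"
  then have "awalk x [(x, y)] y" by (auto simp: awalk_Cons_iff awalk_Nil_iff intro: in_arcsD2 in_arcsD1)
  then have "gdist G x y \<le> 1" using gdist_le_length[of x "[(x, y)]" y] by (simp add: one_ereal_def)
  moreover have "x \<noteq> y" using pair_no_loops[OF xy] by simp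
  ultimately show "gdist G x y = 1" using gdist_ge_1 by (intro antisym) auto
qed

section \<open>Path lengths and the deletion of interior entries\<close>

lemma path_length_Nil [simp]: "path_length G [] = 0"
  and path_length_single [simp]: "path_length G [x] = 0"
  and path_length_Cons [simp]: "path_length G (x # y # xs) = gdist G x y + path_length G (y # xs)"
  unfolding path_length_def by (simp_all add: sum.lessThan_Suc_shift del: sum.lessThan_Suc)

lemma path_length_append:
  "path_length G (xs @ x # ys) = path_length G (xs @ [x]) + path_length G (x # ys)"
proof (induction xs)
  case (Cons z zs)
  then show ?case by (cases zs) (simp_all add: add.assoc)
qed simp

lemma k_paths_iff:
  "xs \<in> k_paths G k \<longleftrightarrow> length xs = k + 1 \<and> set xs \<subseteq> pverts G \<and>
     successively (\<lambda>x y. x \<noteq> y \<and> gdist G x y < \<infinity>) xs"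
  by (auto simp: k_paths_def successively_conv_nth)

lemma length_delete_nth: "i < length xs \<Longrightarrow> length (delete_nth i xs) = length xs - 1"
  by (auto simp: delete_nth_def)

lemma nth_delete_nth:
  "i < length xs \<Longrightarrow> m < length xs - 1 \<Longrightarrow>
    delete_nth i xs ! m = (if m < i then xs ! m else xs ! Suc m)"
  by (auto simp: delete_nth_def nth_append min_def)

lemma delete_nth_delete_nth:
  assumes "i < j" "j < length xs"
  shows "delete_nth i (delete_nth j xs) = delete_nth (j - 1) (delete_nth i xs)"
  using assms by (intro nth_equalityI) (auto simp: length_delete_nth nth_delete_nth)

text \<open>Exposes the deleted entry together with its two neighbours. A deletion changes the
  length only there, so \<open>path_length_append\<close> reduces length comparisons to a single
  triangle.\<close>

lemma interior_decomp:
  assumes "0 < i" "Suc i < length xs"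
  obtains ys a z b zs where "xs = ys @ a # z # b # zs" "delete_nth i xs = ys @ a # b # zs"
    "i = Suc (length ys)"
proof
  let ?ys = "take (i - 1) xs"
  show "xs = ?ys @ xs ! (i - 1) # xs ! i # xs ! Suc i # drop (Suc (Suc i)) xs"
    using assms Cons_nth_drop_Suc[of "i - 1" xs] by (simp add: Cons_nth_drop_Suc)
  moreover have "take i xs = ?ys @ [xs ! (i - 1)]"
    using assms take_Suc_conv_app_nth[of "i - 1" xs] by simp
  ultimately show "delete_nth i xs = ?ys @ xs ! (i - 1) # xs ! Suc i # drop (Suc (Suc i)) xs"
    using assms by (simp add: delete_nth_def Cons_nth_drop_Suc)
  show "i = Suc (length ?ys)" using assms by simp
qed

lemma (in pair_graph) path_length_delete_nth_le:
  assumes "0 < i" "Suc i < length xs"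
  shows "path_length G (delete_nth i xs) \<le> path_length G xs"
proof -
  obtain ys a z b zs where xs: "xs = ys @ a # z # b # zs" "delete_nth i xs = ys @ a # b # zs"
    using interior_decomp[OF assms] by metis
  have "path_length G (a # b # zs) \<le> path_length G (a # z # b # zs)"
    using add_right_mono[OF gdist_triangle[of a b z]] by (simp add: add.assoc)
  then show ?thesis
    unfolding xs(2) unfolding xs(1) path_length_append[of G ys a "b # zs"] path_length_append[of G ys a "z # b # zs"] by (rule add_left_mono)
qed

text \<open>Finiteness of the new step comes from the triangle inequality, so coinciding neighbours
  are the only obstruction.\<close>

lemma (in pair_graph) delete_nth_k_path:
  assumes xs: "xs \<in> k_paths G (Suc k)" and i: "0 < i" "i < Suc k"
    and ne: "xs ! (i - 1) \<noteq> xs ! Suc i"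
  shows "delete_nth i xs \<in> k_paths G k"
proof -
  have "Suc i < length xs" using xs i by (simp add: k_paths_iff)
  then obtain ys a z b zs where eq: "xs = ys @ a # z # b # zs" "delete_nth i xs = ys @ a # b # zs"
      "i = Suc (length ys)"
    using interior_decomp[OF i(1)] by metis
  have "a \<noteq> b" using ne i eq by (simp add: nth_append)
  moreover have "gdist G a b < \<infinity>"
  proof -
    have "gdist G a z < \<infinity>" "gdist G z b < \<infinity>"
      using xs by (auto simp: k_paths_iff eq(1) successively_append_iff successively_Cons)
    then have "gdist G a z + gdist G z b < \<infinity>" by simp
    then show ?thesis using gdist_triangle[of a b z] by (rule order_le_less_trans[rotated])
  qed
  ultimately show ?thesis
    using xs unfolding eq(2) by (auto simp: k_paths_iff eq(1) successively_append_iff successively_Cons)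
qed

text \<open>Interior deletions never increase the length, so if two of them end at length
  \<open>l\<close>, the first cannot have lost anything. Consequently, a face that is sent to 0 has
  no nonzero faces in the iterated boundary.\<close>

lemma (in pair_graph) delete_nth_path_if_delete_nth_delete_nth_path:
  assumes xs: "xs \<in> k_paths_of_length G (Suc k) l" and j: "0 < j" "j < Suc k"
    and i: "0 < i" "i < k"
    and del: "delete_nth i (delete_nth j xs) \<in> k_paths_of_length G (k - 1) l"
  shows "delete_nth j xs \<in> k_paths_of_length G k l"
proof -
  have len: "length xs = Suc (Suc k)" and path: "xs \<in> k_paths G (Suc k)"
    and pl: "path_length G xs = ereal l"
    using xs by (auto simp: k_paths_of_length_def k_paths_iff)
  have "ereal l \<le> path_length G (delete_nth j xs)"
    using path_length_delete_nth_le[of i "delete_nth j xs"] i j len del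
    by (simp add: length_delete_nth k_paths_of_length_def)
  moreover have "path_length G (delete_nth j xs) \<le> ereal l"
    using path_length_delete_nth_le[of j xs] j len pl by simp
  ultimately have dl: "path_length G (delete_nth j xs) = ereal l" by simp
  have "xs ! (j - 1) \<noteq> xs ! Suc j"
  proof
    assume coll: "xs ! (j - 1) = xs ! Suc j"
    have "Suc j < length xs" using len j by simp
    then obtain ys a z b zs where eq: "xs = ys @ a # z # b # zs" "delete_nth j xs = ys @ a # b # zs"
        "j = Suc (length ys)"
      using interior_decomp[OF j(1)] by metis
    have ab: "b = a" using coll eq j by (simp add: nth_append)
    have "a \<noteq> z" "a \<in> pverts G"
      using path by (auto simp: k_paths_iff eq(1) successively_append_iff successively_Cons)
    \<comment> \<open>Between equal neighbours \<open>a\<close>, deleting \<open>z\<close> loses the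
      round trip from \<open>a\<close> to \<open>z\<close> and back, which is at least 1, whereas
      the length is already known to stay \<open>l\<close>.\<close>
    let ?t = "path_length G (ys @ [a]) + path_length G (a # zs)"
    have "path_length G (delete_nth j xs) = ?t"
      using gdist_self[OF \<open>a \<in> pverts G\<close>] unfolding eq(2) ab path_length_append[of G ys a "a # zs"] by simp
    moreover have "path_length G xs = ?t + (gdist G a z + gdist G z a)"
      unfolding eq(1) ab path_length_append[of G ys a "z # a # zs"] by (simp add: ac_simps)
    ultimately have "ereal l = ereal l + (gdist G a z + gdist G z a)" unfolding pl dl by metis
    moreover have "1 \<le> gdist G a z + gdist G z a"
      using add_mono[OF gdist_ge_1[OF \<open>a \<noteq> z\<close>] gdist_nonneg[of z a]] by simp
    ultimately show False
      by (cases "gdist G a z + gdist G z a") (auto simp: one_ereal_def)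
  qed
  then show ?thesis
    using delete_nth_k_path[OF path j] dl by (simp add: k_paths_of_length_def)
qed

section \<open>The magnitude complex\<close>

lemma frag_cmul_diff_distrib2: "frag_cmul c (a - b) = frag_cmul c a - frag_cmul c b"
  by (simp add: poly_mapping_eqI lookup_minus right_diff_distrib)

lemma boundary_0 [simp]: "boundary G k l 0 = 0"
  by (simp add: boundary_def face_def)

lemma boundary_diff: "boundary G k l (a - b) = boundary G k l a - boundary G k l b"
  by (simp add: boundary_def face_def frag_extend_diff frag_cmul_diff_distrib2 sum_subtractf)

lemma boundary_add: "boundary G k l (a + b) = boundary G k l a + boundary G k l b"
  by (simp add: boundary_def face_def frag_extend_add frag_cmul_distrib2 sum.distrib)

lemma boundary_cmul: "boundary G k l (frag_cmul m a) = frag_cmul m (boundary G k l a)"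
  by (simp add: boundary_def face_def frag_extend_cmul frag_cmul_sum mult.commute)

lemma boundary_sum: "boundary G k l (sum f I) = (\<Sum>i\<in>I. boundary G k l (f i))"
  by (induction I rule: infinite_finite_induct) (simp_all add: boundary_add)

lemma boundary_frag_of:
  "boundary G k l (frag_of xs) =
     (\<Sum>i\<in>{1..<k}. frag_cmul ((- 1) ^ i)
       (if delete_nth i xs \<in> k_paths_of_length G (k - 1) l then frag_of (delete_nth i xs) else 0))"
  by (simp add: boundary_def face_def)

lemma keys_boundary: "Poly_Mapping.keys (boundary G k l c) \<subseteq> k_paths_of_length G (k - 1) l"
proof -
  have "Poly_Mapping.keys (face G k l i c) \<subseteq> k_paths_of_length G (k - 1) l" for i
    unfolding face_def by (rule order_trans[OF keys_frag_extend]) (auto split: if_splits)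
  then show ?thesis
    unfolding boundary_def by (intro order_trans[OF keys_sum] UN_least order_trans[OF keys_cmul])
qed

text \<open>The terms cancel in pairs along \<open>(j, i) \<mapsto> (i, j - 1)\<close>.\<close>

lemma simplicial_sum_eq_0:
  fixes T :: "nat \<Rightarrow> nat \<Rightarrow> 'a \<Rightarrow>\<^sub>0 int"
  assumes "\<And>i j. 1 \<le> i \<Longrightarrow> i < j \<Longrightarrow> j \<le> k \<Longrightarrow> T i j = T (j - 1) i"
  shows "(\<Sum>j\<in>{1..<Suc k}. \<Sum>i\<in>{1..<k}. frag_cmul ((- 1) ^ (i + j)) (T i j)) = 0"
proof -
  let ?f = "\<lambda>(j, i). frag_cmul ((- 1) ^ (i + j)) (T i j)"
  let ?S = "{1..<Suc k} \<times> {1..<k}"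
  let ?A = "{(j, i) \<in> ?S. i < j}" and ?B = "{(j, i) \<in> ?S. j \<le> i}"
  have "sum ?f ?A = (\<Sum>p\<in>?B. - ?f p)"
  proof (rule sum.reindex_bij_witness[where j = "\<lambda>(j, i). (i, j - 1)" and i = "\<lambda>(j, i). (Suc i, j)"])
    fix p assume "p \<in> ?A"
    then obtain i j where p: "p = (j, i)" "1 \<le> i" "i < j" "j \<le> k" by auto
    then have "(- 1 :: int) ^ (j - 1 + i) = - ((- 1) ^ (i + j))"
      by (cases j) (simp_all add: add.commute)
    then show "- ?f (case p of (j, i) \<Rightarrow> (i, j - 1)) = ?f p"
      using assms[of i j] p by simp
  qed auto
  moreover have "sum ?f ?S = sum ?f ?A + sum ?f ?B"
  proof (subst sum.union_disjoint[symmetric])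
    show "finite ?A" "finite ?B" by (rule finite_subset[of _ ?S], auto)+
  qed (auto intro!: sum.cong)
  ultimately have "sum ?f ?S = 0" by (simp add: sum_negf)
  then show ?thesis by (simp add: sum.cartesian_product)
qed

lemma (in pair_graph) boundary_boundary:
  assumes "Poly_Mapping.keys c \<subseteq> k_paths_of_length G (Suc k) l"
  shows "boundary G k l (boundary G (Suc k) l c) = 0"
  using assms
proof (induction c rule: frag_induction)
  case (one xs)
  have len: "length xs = Suc (Suc k)"
    using one by (simp add: k_paths_of_length_def k_paths_iff)
  \<comment> \<open>\<open>T\<close> does not ask whether the intermediate tuple is a path of length
    \<open>l\<close>. This makes it symmetric under exchanging the two deletions, and it costs
    nothing: if the intermediate tuple fails the test, all its \<open>T i j\<close> vanish
    anyway.\<close>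
  define T where "T i j = (if delete_nth i (delete_nth j xs) \<in> k_paths_of_length G (k - 1) l
    then frag_of (delete_nth i (delete_nth j xs)) else 0)" for i j
  have "boundary G k l (frag_cmul ((- 1) ^ j)
      (if delete_nth j xs \<in> k_paths_of_length G (Suc k - 1) l then frag_of (delete_nth j xs) else 0))
    = (\<Sum>i\<in>{1..<k}. frag_cmul ((- 1) ^ (i + j)) (T i j))" if "j \<in> {1..<Suc k}" for j
  proof (cases "delete_nth j xs \<in> k_paths_of_length G k l")
    case True
    then show ?thesis
      by (simp add: boundary_cmul boundary_frag_of frag_cmul_sum T_def power_add mult.commute)
  next
    case False
    then have "T i j = 0" if "i \<in> {1..<k}" for i
      using delete_nth_path_if_delete_nth_delete_nth_path[OF one, of j i] that \<open>j \<in> {1..<Suc k}\<close>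
      by (auto simp: T_def)
    then show ?thesis using False by simp
  qed
  then have "boundary G k l (boundary G (Suc k) l (frag_of xs)) =
      (\<Sum>j\<in>{1..<Suc k}. \<Sum>i\<in>{1..<k}. frag_cmul ((- 1) ^ (i + j)) (T i j))"
    unfolding boundary_frag_of[of G "Suc k"] boundary_sum by (intro sum.cong) auto
  also have "\<dots> = 0"
    by (rule simplicial_sum_eq_0) (simp add: T_def len delete_nth_delete_nth)
  finally show ?case .
qed (simp_all add: boundary_diff)

section \<open>Elements of order two in homology\<close>

lemma (in group) subgroup_iso_Z2_if_order_2:
  assumes x: "x \<in> carrier G" and ne: "x \<noteq> \<one>" and sq: "x \<otimes> x = \<one>"
  shows "subgroup {\<one>, x} G" "G\<lparr>carrier := {\<one>, x}\<rparr> \<cong> integer_mod_group 2"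
proof -
  have "inv x = x" using inv_equality x sq by blast
  then show "subgroup {\<one>, x} G"
    using x sq by unfold_locales auto
  have "{0 ..< 2 :: int} = {0, 1}" by auto
  then have "(\<lambda>y. if y = \<one> then 0 else 1) \<in> iso (G\<lparr>carrier := {\<one>, x}\<rparr>) (integer_mod_group 2)"
    using x ne sq
    by (auto simp: iso_def hom_def carrier_integer_mod_group bij_betw_def inj_on_def)
  then show "G\<lparr>carrier := {\<one>, x}\<rparr> \<cong> integer_mod_group 2"
    by (rule is_isoI)
qed

text \<open>Twice the boundary of \<open>c\<close> is the boundary of a boundary, hence 0; chains
  are torsion-free, so \<open>c\<close> is a cycle. Its class is not zero by \<open>c_notin\<close>,
  and doubling it gives the boundary of \<open>b\<close>.\<close>

lemma (in pair_graph) magnitude_homology_Z2: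
  assumes b: "Poly_Mapping.keys b \<subseteq> k_paths_of_length G (Suc k) l"
    and c: "Poly_Mapping.keys c \<subseteq> k_paths_of_length G k l"
    and bc: "boundary G (Suc k) l b = frag_cmul 2 c"
    and c_notin: "\<And>a. Poly_Mapping.keys a \<subseteq> k_paths_of_length G (Suc k) l \<Longrightarrow>
      boundary G (Suc k) l a \<noteq> c"
  shows "\<exists>H. subgroup H (magnitude_homology G k l) \<and>
    (magnitude_homology G k l)\<lparr>carrier := H\<rparr> \<cong> integer_mod_group 2"
proof -
  interpret M: comm_group "MC G k l" unfolding MC_def by (rule abelian_free_Abelian_group)
  have hom: "group_hom (MC G j l) (MC G (j - 1) l) (boundary G j l)" for j
    unfolding group_hom_def group_hom_axioms_def hom_def MC_def
    by (auto simp: boundary_add simp del: One_nat_def dest!: subsetD[OF keys_boundary])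
  let ?Z = "kernel (MC G k l) (MC G (k - 1) l) (boundary G k l)"
  let ?B = "boundary G (Suc k) l ` carrier (MC G (Suc k) l)"
  let ?K = "(MC G k l)\<lparr>carrier := ?Z\<rparr>"
  have Z: "x \<in> ?Z \<longleftrightarrow> Poly_Mapping.keys x \<subseteq> k_paths_of_length G k l \<and> boundary G k l x = 0" for x
    by (auto simp: kernel_def MC_def)
  have subZ: "subgroup ?Z (MC G k l)" using hom by (rule group_hom.subgroup_kernel)
  interpret K: comm_group ?K 
    using subgroup.subgroup_is_group[OF subZ M.group_axioms]
    by (rule group.group_comm_groupI) (simp add: MC_def add.commute)
  have "subgroup ?B (MC G k l)" using group_hom.img_is_subgroup[OF hom[of "Suc k"]] by simp
  moreover have "?B \<subseteq> ?Z"
    using keys_boundary[of G "Suc k" l] boundary_boundary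
    unfolding image_subset_iff Z by (auto simp: MC_def)
  ultimately have subB: "subgroup ?B ?K" using subZ by (intro M.subgroup_incl)
  interpret B: normal ?B ?K using subB by (rule K.subgroup_imp_normal)
  interpret Q: group "?K Mod ?B" by (rule B.factorgroup_is_group)
  have MH: "magnitude_homology G k l = ?K Mod ?B" by (simp add: magnitude_homology_def)
  have "frag_cmul 2 (boundary G k l c) = 0"
    using boundary_boundary[OF b] by (simp add: bc boundary_cmul)
  then have cZ: "c \<in> carrier ?K" using c by (simp add: Z del: One_nat_def)
  have cB: "c \<notin> ?B"
  proof
    assume "c \<in> ?B"
    then obtain a where "Poly_Mapping.keys a \<subseteq> k_paths_of_length G (Suc k) l" "c = boundary G (Suc k) l a"
      by (auto simp: MC_def)
    then show False using c_notin by blast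
  qed
  let ?x = "?B #>\<^bsub>?K\<^esub> c"
  have x: "?x \<in> carrier (?K Mod ?B)"
    unfolding carrier_FactGroup using cZ by (rule imageI)
  have "?x \<noteq> ?B" using cB K.rcos_self[OF cZ subB] by metis
  then have ne: "?x \<noteq> \<one>\<^bsub>?K Mod ?B\<^esub>" unfolding one_FactGroup .
  have "boundary G (Suc k) l b = c + c"
    unfolding bc by (simp add: poly_mapping_eqI lookup_add)
  moreover have "b \<in> carrier (MC G (Suc k) l)" using b by (simp add: MC_def)
  ultimately have ccB: "c + c \<in> ?B" by (metis imageI)
  have "?x \<otimes>\<^bsub>?K Mod ?B\<^esub> ?x = ?B #>\<^bsub>?K\<^esub> (c \<otimes>\<^bsub>?K\<^esub> c)"
    unfolding mult_FactGroup by (rule B.rcos_sum[OF cZ cZ])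
  also have "c \<otimes>\<^bsub>?K\<^esub> c = c + c" by (simp add: MC_def)
  also have "?B #>\<^bsub>?K\<^esub> (c + c) = \<one>\<^bsub>?K Mod ?B\<^esub>"
    unfolding one_FactGroup using subsetD[OF B.subset ccB] subB ccB by (rule K.coset_join2)
  finally have "?x \<otimes>\<^bsub>?K Mod ?B\<^esub> ?x = \<one>\<^bsub>?K Mod ?B\<^esub>" .
  then show ?thesis
    using Q.subgroup_iso_Z2_if_order_2[OF x ne] unfolding MH by blast
qed

section \<open>Graded graphs\<close>

text \<open>Each of the \<open>n\<close> steps has length at least 1, so a total of \<open>n\<close>
  forces every step to have length exactly 1, that is, to be an arc.\<close>

lemma (in pair_graph) k_paths_of_length_self_iff:
  "xs \<in> k_paths_of_length G n n \<longleftrightarrow>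
     length xs = n + 1 \<and> set xs \<subseteq> pverts G \<and> successively (\<lambda>x y. (x, y) \<in> parcs G) xs"
    (is "_ \<longleftrightarrow> ?R")
proof
  assume xs: "xs \<in> k_paths_of_length G n n"
  let ?d = "\<lambda>i. gdist G (xs ! i) (xs ! (i + 1))"
  have len: "length xs = n + 1" and ne: "\<And>i. i < n \<Longrightarrow> xs ! i \<noteq> xs ! (i + 1)"
    and V: "set xs \<subseteq> pverts G" and pl: "(\<Sum>i<n. ?d i) = ereal n"
    using xs by (auto simp: k_paths_of_length_def k_paths_def path_length_def)
  have "?d i = 1" if "i < n" for i
  proof (rule ccontr)
    assume "?d i \<noteq> 1"
    then have "1 < ?d i" using gdist_ge_1[OF ne[OF that]] by (simp add: order_less_le)
    have "ereal n = ?d i + (\<Sum>j\<in>{..<n} - {i}. ?d j)"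
      using pl that by (simp add: sum.remove[of "{..<n}" i])
    moreover have "(\<Sum>j\<in>{..<n} - {i}. (1 :: ereal)) \<le> (\<Sum>j\<in>{..<n} - {i}. ?d j)"
      using ne by (intro sum_mono gdist_ge_1) auto
    moreover have "(\<Sum>j\<in>{..<n} - {i}. (1 :: ereal)) = ereal (n - 1)"
      using that by (simp add: one_ereal_def)
    ultimately show False using \<open>1 < ?d i\<close> that
      by (cases "?d i"; cases "\<Sum>j\<in>{..<n} - {i}. ?d j") (auto simp: one_ereal_def of_nat_diff)
  qed
  then show ?R using len V by (auto simp: successively_conv_nth gdist_eq_1_iff)
next
  assume xs: ?R
  then have 1: "gdist G (xs ! i) (xs ! (i + 1)) = 1" if "i < n" for i
    using that by (auto simp: successively_conv_nth gdist_eq_1_iff)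
  have "xs ! i \<noteq> xs ! (i + 1)" if "i < n" for i
    using 1[OF that] gdist_self[of "xs ! i"] xs that nth_mem[of i xs] by fastforce
  then show "xs \<in> k_paths_of_length G n n"
    using xs 1 by (auto simp: k_paths_of_length_def k_paths_def path_length_def one_ereal_def)
qed

text \<open>Models the Hasse diagram of a graded poset. Arcs run in both directions, and the rank
  tells which end is the lower one.\<close>

locale graded_graph = pair_graph +
  fixes rk :: "'a \<Rightarrow> nat"
  assumes rk_arc: "(x, y) \<in> parcs G \<Longrightarrow> rk y = Suc (rk x) \<or> rk x = Suc (rk y)"
begin

text \<open>A walk gains at most one rank per arc. The resulting lower bound on lengths is what
  keeps the faces of maximal chains at full length.\<close>

lemma rk_le_gdist: "ereal (real (rk y) - real (rk x)) \<le> gdist G x y"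
proof (cases "gdist G x y < \<infinity>")
  case True
  then obtain p where p: "awalk x p y" "gdist G x y = ereal (length p)"
    by (rule gdist_attained)
  have "rk y \<le> rk x + length p"
    using p(1)
  proof (induction p arbitrary: x)
    case (Cons e p)
    then have "rk y \<le> rk (snd e) + length p" "(x, snd e) \<in> parcs G"
      by (auto simp: awalk_Cons_iff)
    then show ?case using rk_arc[of x "snd e"] by auto
  qed (simp add: awalk_Nil_iff)
  then show ?thesis using p(2) by simp
qed auto

lemma rk_le_path_length:
  "xs \<noteq> [] \<Longrightarrow> ereal (real (rk (last xs)) - real (rk (hd xs))) \<le> path_length G xs"
proof (induction xs rule: induct_list012)
  case (3 x y zs)
  then have "ereal (real (rk y) - real (rk x)) + ereal (real (rk (last (y # zs))) - real (rk y))
      \<le> gdist G x y + path_length G (y # zs)"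
    by (intro add_mono rk_le_gdist) simp
  then show ?case by simp
qed (auto simp: zero_ereal_def)

text \<open>The end points are fixed because the differential deletes interior entries only, so it
  respects them. If the rank of \<open>y\<close> exceeds that of \<open>x\<close> by
  \<open>n\<close>, these are the maximal chains between \<open>x\<close> and
  \<open>y\<close>.\<close>

definition flags :: "'a \<Rightarrow> 'a \<Rightarrow> nat \<Rightarrow> 'a list set" where
  "flags x y n = {w \<in> k_paths_of_length G n n. hd w = x \<and> last w = y}"

lemma flags_iff:
  "w \<in> flags x y n \<longleftrightarrow> length w = n + 1 \<and> set w \<subseteq> pverts G \<and>
    (\<forall>i<n. (w ! i, w ! Suc i) \<in> parcs G) \<and> w ! 0 = x \<and> w ! n = y"
  by (cases w) (auto simp: flags_def k_paths_of_length_self_iff successively_conv_nth last_conv_nth)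

lemma flag_arc: "w \<in> flags x y n \<Longrightarrow> i < n \<Longrightarrow> (w ! i, w ! Suc i) \<in> parcs G"
  by (simp add: flags_iff)

lemma finite_flags: "finite (flags x y n)"
  by (rule finite_subset[OF _ finite_lists_length_eq[OF pair_finite_verts, of "n + 1"]])
    (auto simp: flags_iff)

text \<open>There are just enough steps to climb from \<open>x\<close> to \<open>y\<close>, so every
  step ascends: counting from \<open>x\<close> bounds the rank above, counting back from
  \<open>y\<close> bounds it below.\<close>

lemma rk_nth_flag:
  assumes w: "w \<in> flags x y n" and rk: "rk y = rk x + n" and i: "i \<le> n"
  shows "rk (w ! i) = rk x + i"
proof -
  have "i \<le> n \<Longrightarrow> rk (w ! i) \<le> rk x + i"
  proof (induction i)
    case (Suc i)
    then show ?case using w rk_arc[of "w ! i" "w ! Suc i"] by (auto simp: flags_iff)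
  qed (use w in \<open>simp add: flags_iff\<close>)
  moreover have "rk y \<le> rk (w ! i) + (n - i)"
    using i
  proof (induction i rule: inc_induct)
    case (step m)
    then show ?case using w rk_arc[of "w ! m" "w ! Suc m"] by (auto simp: flags_iff)
  qed (use w in \<open>simp add: flags_iff\<close>)
  ultimately show ?thesis using rk i by simp
qed

text \<open>The triangle inequality bounds the length of the face above and the rank gap bounds it
  below, by the same number. The new neighbours are two ranks apart, hence distinct. So no face of a
  flag is sent to 0.\<close>

lemma delete_nth_flag:
  assumes w: "w \<in> flags x y (Suc n)" and rk: "rk y = rk x + Suc n" and i: "0 < i" "i < Suc n"
  shows "delete_nth i w \<in> k_paths_of_length G n (Suc n)"
    "hd (delete_nth i w) = x" "last (delete_nth i w) = y"
proof -
  have len: "length w = Suc (Suc n)" using w by (simp add: flags_iff)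
  obtain ys a z b zs where eq: "w = ys @ a # z # b # zs" "delete_nth i w = ys @ a # b # zs"
    using interior_decomp[OF i(1), of w] len i(2) by (metis Suc_less_eq)
  then have "hd (delete_nth i w) = hd w" "last (delete_nth i w) = last w"
    by (auto simp: hd_append)
  then show ends: "hd (delete_nth i w) = x" "last (delete_nth i w) = y"
    using w by (simp_all add: flags_def)
  have path: "w \<in> k_paths G (Suc n)" "path_length G w = ereal (Suc n)"
    using w by (auto simp: flags_def k_paths_of_length_def)
  have "path_length G (delete_nth i w) \<le> ereal (Suc n)"
    using path_length_delete_nth_le[of i w] i len path(2) by simp
  moreover have "ereal (Suc n) \<le> path_length G (delete_nth i w)"
    using rk_le_path_length[of "delete_nth i w"] ends rk by (simp add: eq(2))
  moreover have "w ! (i - 1) \<noteq> w ! Suc i"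
  proof
    assume "w ! (i - 1) = w ! Suc i"
    then have "rk x + (i - 1) = rk x + Suc i"
      using rk_nth_flag[OF w rk, of "i - 1"] rk_nth_flag[OF w rk, of "Suc i"] i by simp
    then show False by simp
  qed
  ultimately show "delete_nth i w \<in> k_paths_of_length G n (Suc n)"
    using delete_nth_k_path[OF path(1) i] by (simp add: k_paths_of_length_def)
qed

text \<open>The missing rank can be read off a face. At the smaller of two different deleted
  positions, one face has already skipped a rank and the other has not.\<close>

lemma delete_nth_flag_eqD:
  assumes "w \<in> flags x y (Suc n)" "w' \<in> flags x y (Suc n)" "rk y = rk x + Suc n"
    and "i < Suc n" "j < Suc n" "delete_nth i w = delete_nth j w'"
  shows "i = j"
proof -
  have False if "u \<in> flags x y (Suc n)" "v \<in> flags x y (Suc n)" "a < b" "b < Suc n"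
    "delete_nth a u = delete_nth b v" for u v a b
  proof -
    have "length u = Suc (Suc n)" "length v = Suc (Suc n)" using that by (auto simp: flags_iff)
    then have "u ! Suc a = v ! a"
      using that(3,4) arg_cong[OF that(5), of "\<lambda>xs. xs ! a"] by (simp add: nth_delete_nth)
    then show False
      using that assms(3) rk_nth_flag[of u x y "Suc n" "Suc a"] rk_nth_flag[of v x y "Suc n" a] by simp
  qed
  then show ?thesis using assms by (metis linorder_neqE_nat)
qed

text \<open>Turns the number of flags sharing a face into the number of midpoints of an interval of
  length two, which thinness controls.\<close>

lemma flags_delete_nth_fibre:
  assumes w: "w \<in> flags x y n" and i: "0 < i" "i < n"
  shows "{w' \<in> flags x y n. delete_nth i w' = delete_nth i w} =
    (\<lambda>z. w[i := z]) ` {z. (w ! (i - 1), z) \<in> parcs G \<and> (z, w ! Suc i) \<in> parcs G}" (is "?L = ?R")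
proof (intro equalityI subsetI)
  fix w' assume w': "w' \<in> ?L"
  have len: "length w = Suc n" "length w' = Suc n" using w w' by (auto simp: flags_iff)
  have del: "delete_nth i w' ! m = delete_nth i w ! m" for m
    using w' by simp
  have eq: "w' ! m = w ! m" if "m \<noteq> i" "m \<le> n" for m
  proof (cases "m < i")
    case True
    then show ?thesis using del[of m] len i that by (simp add: nth_delete_nth)
  next
    case False
    then show ?thesis using del[of "m - 1"] len i that by (cases m) (simp_all add: nth_delete_nth)
  qed
  have "w' = w[i := w' ! i]"
  proof (rule nth_equalityI)
    show "w' ! m = w[i := w' ! i] ! m" if "m < length w'" for m
      using that len eq[of m] by (cases "m = i") auto
  qed (simp add: len)
  moreover have "(w ! (i - 1), w' ! i) \<in> parcs G" "(w' ! i, w ! Suc i) \<in> parcs G"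
  proof -
    have "(w' ! (i - 1), w' ! Suc (i - 1)) \<in> parcs G" "(w' ! i, w' ! Suc i) \<in> parcs G"
      using w' i by (auto intro!: flag_arc simp del: Suc_pred)
    then show "(w ! (i - 1), w' ! i) \<in> parcs G" "(w' ! i, w ! Suc i) \<in> parcs G"
      using eq[of "i - 1"] eq[of "Suc i"] i by auto
  qed
  ultimately show "w' \<in> ?R" by blast
next
  fix w' assume "w' \<in> ?R"
  then obtain z where z: "w' = w[i := z]" "(w ! (i - 1), z) \<in> parcs G" "(z, w ! Suc i) \<in> parcs G"
    by blast
  have "(w' ! m, w' ! Suc m) \<in> parcs G" if "m < n" for m
  proof -
    consider "m = i" | "Suc m = i" | "m \<noteq> i" "Suc m \<noteq> i" by blast
    then show ?thesis
      using w z i that by cases (auto simp: flags_iff nth_list_update)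
  qed
  moreover have "set w' \<subseteq> pverts G"
    using w z in_arcsD2[OF z(2)] set_update_subset_insert[of w i z] by (auto simp: flags_iff)
  ultimately have "w' \<in> flags x y n" using w i z(1) by (auto simp: flags_iff nth_list_update)
  moreover have "delete_nth i w' = delete_nth i w" by (simp add: delete_nth_def z(1))
  ultimately show "w' \<in> ?L" by simp
qed

text \<open>
  Here \<open>C\<close> is a mod 2 cocycle: the sum of the coefficients over \<open>C\<close> is even on boundaries, but odd on
  half of the boundary of the sum of all flags.
\<close>

theorem thin_magnitude_homology_Z2:
  assumes rk: "rk y = rk x + Suc n"
    and thin: "\<And>u z v. (u, z) \<in> parcs G \<Longrightarrow> (z, v) \<in> parcs G \<Longrightarrow> rk v = Suc (Suc (rk u)) \<Longrightarrow>
      card {z. (u, z) \<in> parcs G \<and> (z, v) \<in> parcs G} = 2"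
    and finC: "finite C" and oddC: "odd (card C)"
    and C: "\<And>r. r \<in> C \<Longrightarrow> \<exists>w\<in>flags x y (Suc n). \<exists>i\<in>{1..<Suc n}. r = delete_nth i w"
    and even: "\<And>w. w \<in> flags x y (Suc n) \<Longrightarrow> even (card {i\<in>{1..<Suc n}. delete_nth i w \<in> C})"
  shows "\<exists>H. subgroup H (magnitude_homology G n (Suc n)) \<and>
    (magnitude_homology G n (Suc n))\<lparr>carrier := H\<rparr> \<cong> integer_mod_group 2"
proof -
  let ?F = "flags x y (Suc n)" and ?P = "k_paths_of_length G n (Suc n)"
  define b where "b = (\<Sum>w\<in>?F. frag_of w)"
  \<comment> \<open>The chain \<open>c\<close> takes every face once, with the sign of its deleted
    position. This is half of the boundary of \<open>b\<close>, since exactly two flags meet in each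
    face and contribute with the same sign.\<close>
  define c where "c = (\<Sum>i\<in>{1..<Suc n}. frag_cmul ((- 1) ^ i) (\<Sum>r\<in>delete_nth i ` ?F. frag_of r))"
  have row: "delete_nth i w \<in> ?P" if "w \<in> ?F" "i \<in> {1..<Suc n}" for w i
    using delete_nth_flag(1)[OF that(1) rk] that(2) by simp
  have fibre: "(\<Sum>w\<in>?F. frag_of (delete_nth i w)) =
      frag_cmul 2 (\<Sum>r\<in>delete_nth i ` ?F. frag_of r)" if i: "i \<in> {1..<Suc n}" for i
  proof -
    have card: "card {w' \<in> ?F. delete_nth i w' = delete_nth i w} = 2" if w: "w \<in> ?F" for w
    proof -
      have len: "length w = Suc (Suc n)" using w by (simp add: flags_iff)
      have "(w ! (i - 1), w ! Suc (i - 1)) \<in> parcs G" "(w ! i, w ! Suc i) \<in> parcs G"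
        using i by (auto intro!: flag_arc[OF w] simp del: Suc_pred)
      moreover have "rk (w ! Suc i) = Suc (Suc (rk (w ! (i - 1))))"
        using rk_nth_flag[OF w rk, of "Suc i"] rk_nth_flag[OF w rk, of "i - 1"] i
        by (cases i) auto
      ultimately have "card {z. (w ! (i - 1), z) \<in> parcs G \<and> (z, w ! Suc i) \<in> parcs G} = 2"
        using i by (intro thin[of _ "w ! i"]) auto
      moreover have "inj_on (\<lambda>z. w[i := z]) Z" for Z
        using i len by (auto simp: inj_on_def dest: arg_cong[where f = "\<lambda>xs. xs ! i"])
      ultimately show ?thesis
        using i by (subst flags_delete_nth_fibre[OF w]) (auto simp: card_image)
    qed
    have "(\<Sum>w\<in>?F. frag_of (delete_nth i w)) =
        (\<Sum>r\<in>delete_nth i ` ?F. \<Sum>w\<in>{w' \<in> ?F. delete_nth i w' = r}. frag_of (delete_nth i w))"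
      by (rule sum.image_gen[OF finite_flags])
    also have "\<dots> = (\<Sum>r\<in>delete_nth i ` ?F. frag_cmul 2 (frag_of r))"
    proof (rule sum.cong[OF refl])
      fix r assume "r \<in> delete_nth i ` ?F"
      then have "card {w' \<in> ?F. delete_nth i w' = r} = 2" using card by auto
      then obtain w1 w2 where "{w' \<in> ?F. delete_nth i w' = r} = {w1, w2}" "w1 \<noteq> w2"
        by (auto simp: card_2_iff)
      moreover from this(1) have "delete_nth i w1 = r" "delete_nth i w2 = r" by blast+
      ultimately show "(\<Sum>w\<in>{w' \<in> ?F. delete_nth i w' = r}. frag_of (delete_nth i w)) =
          frag_cmul 2 (frag_of r)"
        by (simp add: poly_mapping_eqI lookup_add)
    qed
    finally show ?thesis by (simp add: frag_cmul_sum)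
  qed
  have "boundary G (Suc n) (Suc n) b =
      (\<Sum>w\<in>?F. \<Sum>i\<in>{1..<Suc n}. frag_cmul ((- 1) ^ i) (frag_of (delete_nth i w)))"
    unfolding b_def boundary_sum boundary_frag_of by (intro sum.cong refl) (use row in auto)
  also have "\<dots> = (\<Sum>i\<in>{1..<Suc n}. frag_cmul ((- 1) ^ i) (\<Sum>w\<in>?F. frag_of (delete_nth i w)))"
    by (subst sum.swap) (simp add: frag_cmul_sum)
  also have "\<dots> = frag_cmul 2 c"
    unfolding c_def frag_cmul_sum[of 2] by (intro sum.cong refl) (simp add: fibre mult.commute)
  finally have bc: "boundary G (Suc n) (Suc n) b = frag_cmul 2 c" .
  \<comment> \<open>Only the parity of \<phi> matters, so it may be taken over the integers and all
    signs drop out.\<close>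
  define \<phi> where "\<phi> a = (\<Sum>r\<in>C. Poly_Mapping.lookup a r)" for a :: "'a list \<Rightarrow>\<^sub>0 int"
  have \<phi>_boundary: "even (\<phi> (boundary G (Suc n) (Suc n) a))"
    if "Poly_Mapping.keys a \<subseteq> k_paths_of_length G (Suc n) (Suc n)" for a
    using that
  proof (induction a rule: frag_induction)
    case zero
    then show ?case by (simp add: \<phi>_def)
  next
    case (diff a b)
    then show ?case by (simp add: boundary_diff \<phi>_def lookup_minus sum_subtractf)
  next
    case (one w)
    let ?I = "{i\<in>{1..<Suc n}. delete_nth i w \<in> C}"
    have CP: "C \<subseteq> ?P" using C row by blast
    have "\<phi> (boundary G (Suc n) (Suc n) (frag_of w)) =
        (\<Sum>i\<in>{1..<Suc n}. (- 1) ^ i * (if delete_nth i w \<in> C then 1 else 0))"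
      unfolding \<phi>_def boundary_frag_of lookup_sum
      using CP finC by (subst sum.swap, intro sum.cong refl) (auto simp: sum_distrib_left[symmetric] if_distrib cong: if_cong)
    also have "\<dots> = (\<Sum>i\<in>?I. (- 1) ^ i)"
      by (rule sum.mono_neutral_cong_right) auto
    \<comment> \<open>Every summand is 1 or -1, hence odd, so the parity of the sum is that of the
      number of summands.\<close>
    finally have "even (\<phi> (boundary G (Suc n) (Suc n) (frag_of w))) \<longleftrightarrow> even (card ?I)"
      by (simp add: even_sum_iff)
    moreover have "even (card ?I)"
    proof (cases "w \<in> ?F")
      case False
      \<comment> \<open>Interior deletions keep the end points, and members of \<open>C\<close> run
        from \<open>x\<close> to \<open>y\<close>; a generator with other end points has no face in
        \<open>C\<close>.\<close>
      have "?I = {}"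
      proof (intro equals0I)
        fix i assume i: "i \<in> ?I"
        then have "hd (delete_nth i w) = x" "last (delete_nth i w) = y"
          using C[of "delete_nth i w"] delete_nth_flag(2,3)[OF _ rk] by auto
        moreover have "hd (delete_nth i w) = hd w" "last (delete_nth i w) = last w"
          using i one by (auto simp: delete_nth_def hd_append k_paths_of_length_self_iff)
        ultimately show False using one False by (simp add: flags_def)
      qed
      then show ?thesis by (simp only: card.empty dvd_0_right)
    qed (rule even)
    ultimately show ?case by simp
  qed
  have "odd (Poly_Mapping.lookup c r)" if r: "r \<in> C" for r
  proof -
    obtain w i where w: "w \<in> ?F" "i \<in> {1..<Suc n}" "r = delete_nth i w" using C[OF r] by blast
    \<comment> \<open>The missing rank of \<open>r\<close> is unique, so \<open>r\<close> occurs in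
      just one of the sums that make up \<open>c\<close>, with coefficient 1 or -1.\<close>
    have "r \<in> delete_nth j ` ?F \<longleftrightarrow> j = i" if "j \<in> {1..<Suc n}" for j
      using w that delete_nth_flag_eqD[OF w(1) _ rk, of _ i j] by auto
    then have "Poly_Mapping.lookup c r = (\<Sum>j\<in>{1..<Suc n}. if j = i then (- 1) ^ j else 0)"
      unfolding c_def lookup_sum by (intro sum.cong refl) (simp add: lookup_sum finite_flags)
    also have "\<dots> = (- 1) ^ i" using w(2) by simp
    finally show ?thesis by simp
  qed
  then have "{r \<in> C. odd (Poly_Mapping.lookup c r)} = C" by blast
  then have \<phi>_c: "odd (\<phi> c)" using oddC finC by (simp add: \<phi>_def even_sum_iff)
  show ?thesis
  proof (rule magnitude_homology_Z2[OF _ _ bc])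
    show "Poly_Mapping.keys b \<subseteq> k_paths_of_length G (Suc n) (Suc n)"
      unfolding b_def by (rule order_trans[OF keys_sum]) (auto simp: flags_def)
    show "Poly_Mapping.keys c \<subseteq> ?P"
      unfolding c_def
      by (intro order_trans[OF keys_sum] UN_least order_trans[OF keys_cmul]) (use row in auto)
  qed (use \<phi>_boundary \<phi>_c in metis)
qed

end

section \<open>Suspensions of the projective plane\<close>

text \<open>
  The vertex \<open>6 r + i\<close> is the \<open>i\<close>-th element of rank \<open>r\<close>. Rank 0 and rank \<open>k + 1\<close> hold the bottom
  and the top, ranks 1, 2, 3 the 3 vertices, 6 edges and 4 triangles of the hemi-octahedron, that is,
  the nonzero sign vectors in \<open>{-, 0, +}\<^sup>3\<close> up to negation, and each rank from 4 to \<open>k\<close> the two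
  points of a suspension. The edges \<open>i\<close> and \<open>i + 3\<close>, for \<open>i < 3\<close>, are those with zero \<open>i\<close>-th entry, with
  equal and with opposite remaining signs. Triangle 3 is \<open>(+, +, +)\<close>; in triangle \<open>j < 3\<close> it is the
  \<open>j\<close>-th sign that differs from the two others.
\<close>

definition level_width :: "nat \<Rightarrow> nat \<Rightarrow> nat" where
  "level_width k r = (if r = 0 \<or> r = Suc k then 1 else if r = 1 then 3 else if r = 2 then 6
     else if r = 3 then 4 else 2)"

definition incident :: "nat \<Rightarrow> nat \<Rightarrow> nat \<Rightarrow> bool" where
  "incident r i j \<longleftrightarrow> (if r = 1 then j mod 3 \<noteq> i
     else if r = 2 then i < 3 \<longleftrightarrow> j = 3 \<or> j = i mod 3 else True)"

definition covers :: "nat \<Rightarrow> nat \<Rightarrow> bool" where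
  "covers x y \<longleftrightarrow> y div 6 = Suc (x div 6) \<and> incident (x div 6) (x mod 6) (y mod 6)"

definition suspended_RP2_verts :: "nat \<Rightarrow> nat set" where
  "suspended_RP2_verts k = {v. v div 6 \<le> Suc k \<and> v mod 6 < level_width k (v div 6)}"

definition suspended_RP2 :: "nat \<Rightarrow> nat pair_pre_digraph" where
  "suspended_RP2 k = \<lparr>pverts = suspended_RP2_verts k,
     parcs = {(x, y). x \<in> suspended_RP2_verts k \<and> y \<in> suspended_RP2_verts k \<and>
       (covers x y \<or> covers y x)}\<rparr>"

lemma graded_graph_suspended_RP2: "graded_graph (suspended_RP2 k) (\<lambda>v. v div 6)"
proof -
  have fin: "finite (suspended_RP2_verts k)"
    by (rule finite_subset[of _ "{..<6 * (k + 2)}"]) (auto simp: suspended_RP2_verts_def)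
  have "finite (parcs (suspended_RP2 k))"
    by (rule finite_subset[OF _ finite_cartesian_product[OF fin fin]])
      (auto simp: suspended_RP2_def)
  then show ?thesis
    using fin
    by unfold_locales
      (auto simp: suspended_RP2_def covers_def symmetric_def sym_def arcs_ends_def arc_to_ends_def)
qed

section \<open>Intervals of length two have two midpoints\<close>

lemma card_Collect_less: "card {j\<in>{..<m}. P j} = length (filter P [0..<m])"
proof -
  have "{j\<in>{..<m}. P j} = set (filter P [0..<m])" by auto
  then show ?thesis using distinct_card[of "filter P [0..<m]"] by simp
qed

text \<open>Rank by rank: an edge has two end points; a triangle of the hemi-octahedron contains
  every vertex, and two of its edges meet there; an edge lies in two triangles; a suspension level
  has two points, incident with everything. The cases within the hemi-octahedron are finite and
  evaluated on lists.\<close>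

lemma card_incident_between:
  assumes "3 \<le> k" "r < k" "a < level_width k r" "b < level_width k (Suc (Suc r))"
  shows "card {j\<in>{..<level_width k (Suc r)}. incident r a j \<and> incident (Suc r) j b} = 2"
proof -
  consider "r = 0" | "r = 1" | "r = 2" | "3 \<le> r" by linarith
  then show ?thesis
  proof cases
    case 1
    have "\<forall>b\<in>set [0..<6]. length (filter (\<lambda>j. incident 0 0 j \<and> incident 1 j b) [0..<3]) = 2"
      by code_simp
    then show ?thesis using assms 1 unfolding card_Collect_less by (simp add: level_width_def)
  next
    case 2
    have "\<forall>a\<in>set [0..<3]. \<forall>b\<in>set [0..<4].
        length (filter (\<lambda>j. incident 1 a j \<and> incident 2 j b) [0..<6]) = 2"
      by code_simp
    then show ?thesis using assms 2 unfolding card_Collect_less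
      by (simp add: level_width_def numeral_2_eq_2)
  next
    case 3
    have "\<forall>a\<in>set [0..<6]. length (filter (\<lambda>j. incident 2 a j) [0..<4]) = 2"
      by code_simp
    moreover have "incident 3 j b" for j by (simp add: incident_def)
    ultimately show ?thesis using assms 3 unfolding card_Collect_less
      by (simp add: level_width_def numeral_2_eq_2 numeral_3_eq_3)
  next
    case 4
    then show ?thesis using assms unfolding card_Collect_less
      by (simp add: level_width_def incident_def)
  qed
qed

text \<open>Arcs change the rank by one, so a common neighbour of vertices two ranks apart lies
  strictly between them. It is then determined by its index \<open>j\<close>, and
  \<open>card_incident_between\<close> counts the indices.\<close>

lemma suspended_RP2_thin:
  assumes k: "3 \<le> k" and uz: "(u, z) \<in> parcs (suspended_RP2 k)" and zv: "(z, v) \<in> parcs (suspended_RP2 k)"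
    and rk: "v div 6 = Suc (Suc (u div 6))"
  shows "card {z. (u, z) \<in> parcs (suspended_RP2 k) \<and> (z, v) \<in> parcs (suspended_RP2 k)} = 2"
proof -
  let ?r = "u div 6"
  let ?J = "{j\<in>{..<level_width k (Suc ?r)}. incident ?r (u mod 6) j \<and> incident (Suc ?r) j (v mod 6)}"
  have uv: "u \<in> suspended_RP2_verts k" "v \<in> suspended_RP2_verts k"
    using uz zv by (auto simp: suspended_RP2_def)
  \<comment> \<open>With at most six vertices per rank, quotient and remainder by 6 recover the rank
    and the index from the vertex.\<close>
  have width: "level_width k r \<le> 6" for r by (simp add: level_width_def)
  have "{z. (u, z) \<in> parcs (suspended_RP2 k) \<and> (z, v) \<in> parcs (suspended_RP2 k)} =
      (\<lambda>j. 6 * Suc ?r + j) ` ?J" (is "?L = ?R")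
  proof (intro equalityI subsetI)
    fix z assume "z \<in> ?L"
    then have zV: "z \<in> suspended_RP2_verts k" and "covers u z \<or> covers z u" "covers z v \<or> covers v z"
      by (auto simp: suspended_RP2_def)
    moreover have "\<not> covers z u \<or> \<not> covers v z" "\<not> covers z u \<or> \<not> covers z v" "\<not> covers u z \<or> \<not> covers v z"
      unfolding covers_def using rk by linarith+
    ultimately have z: "z \<in> suspended_RP2_verts k" "covers u z" "covers z v" by blast+
    then have "z = 6 * Suc ?r + z mod 6"
      using mult_div_mod_eq[of 6 z] by (simp add: covers_def)
    moreover have "z mod 6 \<in> ?J" using z by (auto simp: covers_def suspended_RP2_verts_def)
    ultimately show "z \<in> ?R" by (rule image_eqI)
  next
    fix z assume "z \<in> ?R"
    then obtain j where j: "j \<in> ?J" "z = j + Suc ?r * 6" by (auto simp: algebra_simps)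
    then have "j < 6" using width[of "Suc ?r"] by simp
    then have "z div 6 = Suc ?r" "z mod 6 = j" using j(2) by (simp_all del: mult_Suc)
    then show "z \<in> ?L"
      using j uv rk by (auto simp: suspended_RP2_def suspended_RP2_verts_def covers_def)
  qed
  moreover have "card ?J = 2"
    using uv rk k by (intro card_incident_between) (auto simp: suspended_RP2_verts_def)
  ultimately show ?thesis by (simp add: card_image inj_on_def)
qed

section \<open>Flags of the hemi-octahedron and the cocycle of its double cover\<close>

definition RP2_flags :: "(nat \<times> nat \<times> nat) list" where
  "RP2_flags = [(a, b, c). a \<leftarrow> [6..<9], b \<leftarrow> [12..<18], c \<leftarrow> [18..<22], covers a b \<and> covers b c]"

text \<open>
  Lift each face of the hemi-octahedron to the sign vector whose first nonzero sign is positive. The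
  pairs below are the incident faces whose lifts are not incident; they form the mod 2 cocycle of
  the double cover of the projective plane by the sphere.
\<close>

definition RP2_cocycle :: "(nat \<times> nat) list" where
  "RP2_cocycle =
     [(7, 17), (8, 15), (8, 16), (7, 18), (7, 19), (8, 18), (8, 20), (12, 18), (15, 19)]"

text \<open>The relative sign of the lifts of \<open>a\<close> and \<open>c\<close> is the product
  of those for \<open>a\<close>, \<open>b\<close> and for \<open>b\<close>, \<open>c\<close>. Hence
  each flag contains an even number of pairs of the cocycle.\<close>

lemma RP2_cocycle:
  assumes "(a, b, c) \<in> set RP2_flags"
  shows "(a, c) \<in> set RP2_cocycle \<longleftrightarrow>
    ((a, b) \<in> set RP2_cocycle) \<noteq> ((b, c) \<in> set RP2_cocycle)"
proof -
  have "\<forall>(a, b, c)\<in>set RP2_flags. ((a, c) \<in> set RP2_cocycle) =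
    (((a, b) \<in> set RP2_cocycle) \<noteq> ((b, c) \<in> set RP2_cocycle))"
    by code_simp
  then show ?thesis using assms by blast
qed

text \<open>Guarantees that the tuples built from the cocycle really are faces of flags, as
  \<open>thin_magnitude_homology_Z2\<close> demands of \<open>C\<close>.\<close>

lemma RP2_cocycle_extend:
  assumes "p \<in> set RP2_cocycle"
  obtains a b c where "(a, b, c) \<in> set RP2_flags" "p = (b, c) \<or> p = (a, c) \<or> p = (a, b)"
proof -
  have "\<forall>p\<in>set RP2_cocycle. \<exists>(a, b, c)\<in>set RP2_flags. p = (b, c) \<or> p = (a, c) \<or> p = (a, b)"
    by code_simp
  then show ?thesis using assms that by blast
qed

text \<open>Translates the explicit list, which suits evaluation, into ranks and indices, which suit
  flags. Rank 2 uses all six remainders, hence the absence of a bound on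
  \<open>b mod 6\<close>.\<close>

lemma set_RP2_flags:
  "(a, b, c) \<in> set RP2_flags \<longleftrightarrow> a div 6 = 1 \<and> a mod 6 < 3 \<and> b div 6 = 2 \<and> c div 6 = 3 \<and> c mod 6 < 4 \<and>
     covers a b \<and> covers b c"
proof -
  have "(a, b, c) \<in> set RP2_flags \<longleftrightarrow> a \<in> {6..<9} \<and> b \<in> {12..<18} \<and> c \<in> {18..<22} \<and>
      covers a b \<and> covers b c"
    unfolding RP2_flags_def by (auto simp del: upt_rec_numeral)
  moreover have "a \<in> {6..<9} \<longleftrightarrow> a div 6 = 1 \<and> a mod 6 < 3"
    unfolding atLeastLessThan_iff by presburger
  moreover have "b \<in> {12..<18} \<longleftrightarrow> b div 6 = 2"
    unfolding atLeastLessThan_iff by presburger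
  moreover have "c \<in> {18..<22} \<longleftrightarrow> c div 6 = 3 \<and> c mod 6 < 4"
    unfolding atLeastLessThan_iff by presburger
  ultimately show ?thesis by blast
qed

section \<open>The cocycle carried through the suspension\<close>

theorem magnitude_homology_suspended_RP2:
  assumes k: "3 \<le> k"
  shows "\<exists>H. subgroup H (magnitude_homology (suspended_RP2 k) k (Suc k)) \<and>
    (magnitude_homology (suspended_RP2 k) k (Suc k))\<lparr>carrier := H\<rparr> \<cong> integer_mod_group 2"
proof -
  interpret graded_graph "suspended_RP2 k" "\<lambda>v. v div 6" by (rule graded_graph_suspended_RP2)
  let ?V = "suspended_RP2_verts k" and ?F = "flags 0 (6 * Suc k) (Suc k)"
  \<comment> \<open>One chosen chain through the upper ranks: index 0 at each of the ranks 4 to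
    \<open>k + 1\<close>, the last entry being the top. For \<open>k = 3\<close> it is the top
    alone.\<close>
  define tail where "tail = map ((*) 6) [4..<Suc (Suc k)]"
  \<comment> \<open>Faces whose missing rank is 1, 2 or 3, whose remaining pair lies in the cocycle
    and whose upper part is the chosen chain. Fixing that chain extends the cocycle over the
    suspension.\<close>
  define C where "C = (\<lambda>(a, b). 0 # a # b # tail) ` set RP2_cocycle"
  have rk: "6 * Suc k div 6 = 0 div 6 + Suc k" by simp
  have tail_in: "0 # a # b # c # tail \<in> ?F" if abc: "(a, b, c) \<in> set RP2_flags" for a b c
  proof -
    have "{0, a, b, c} \<subseteq> ?V"
      using abc k by (simp add: suspended_RP2_verts_def set_RP2_flags level_width_def)
    moreover have "set tail \<subseteq> ?V"
      by (auto simp: suspended_RP2_verts_def tail_def level_width_def simp del: upt_Suc)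
    ultimately have V: "set (0 # a # b # c # tail) \<subseteq> ?V" by simp
    have nth_tail: "tail ! i = 6 * (i + 4)" if "i < k - 2" for i
      using that by (simp add: tail_def del: upt_Suc)
    have len: "length tail = k - 2" by (simp add: tail_def del: upt_Suc)
    have cov: "covers ((0 # a # b # c # tail) ! i) ((0 # a # b # c # tail) ! Suc i)" if "i < Suc k" for i
    proof -
      consider "i = 0" | "i = 1" | "i = 2" | "i = 3" | "4 \<le> i" by linarith
      then show ?thesis
      proof cases
        case 4
        then show ?thesis using abc nth_tail[of 0] k by (auto simp: set_RP2_flags covers_def incident_def)
      next
        case 5
        then obtain j where "i = Suc (Suc (Suc (Suc j)))" by atomize_elim presburger
        moreover have "covers (6 * (j + 4)) (6 * (Suc j + 4))"
          unfolding covers_def incident_def nonzero_mult_div_cancel_left[OF zero_neq_numeral[symmetric]] by simp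
        ultimately show ?thesis using that nth_tail[of j] nth_tail[of "Suc j"] by simp
      qed (use abc in \<open>auto simp: set_RP2_flags covers_def incident_def\<close>)
    qed
    have inV: "(0 # a # b # c # tail) ! i \<in> ?V" if "i \<le> Suc k" for i
    proof -
      have "(0 # a # b # c # tail) ! i \<in> set (0 # a # b # c # tail)"
        using that len k by (intro nth_mem) auto
      then show ?thesis using V by blast
    qed
    have "((0 # a # b # c # tail) ! i, (0 # a # b # c # tail) ! Suc i) \<in> parcs (suspended_RP2 k)"
      if "i < Suc k" for i
      using cov[OF that] inV[of i] inV[of "Suc i"] that by (simp add: suspended_RP2_def)
    moreover have "(0 # a # b # c # tail) ! Suc k = 6 * Suc k"
    proof -
      \<comment> \<open>Position \<open>k + 1\<close> of the flag is position
        \<open>m = k - 3\<close> of \<open>tail\<close>, where the entry is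
        \<open>6 * (m + 4)\<close>.\<close>
      obtain m where "k = Suc (Suc (Suc m))" using k by atomize_elim presburger
      then show ?thesis using nth_tail[of m] by simp
    qed
    ultimately show ?thesis
      using V len k unfolding flags_iff by (simp add: suspended_RP2_def)
  qed
  have flag_cases: "\<exists>a b c tl. w = 0 # a # b # c # tl \<and> (a, b, c) \<in> set RP2_flags" if w: "w \<in> ?F" for w
  proof -
    have len: "length w = Suc (Suc k)" using w by (simp add: flags_iff)
    then obtain a b c tl where eq: "w = 0 # a # b # c # tl"
      using w k by (cases w; cases "tl w"; cases "tl (tl w)"; cases "tl (tl (tl w))") (auto simp: flags_iff)
    have rks: "a div 6 = 1" "b div 6 = 2" "c div 6 = 3"
      using rk_nth_flag[OF w rk, of 1] rk_nth_flag[OF w rk, of 2] rk_nth_flag[OF w rk, of 3] k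
      by (simp_all add: eq)
    have "(a, b) \<in> parcs (suspended_RP2 k)" "(b, c) \<in> parcs (suspended_RP2 k)"
      using flag_arc[OF w, of 1] flag_arc[OF w, of 2] k by (simp_all add: eq)
    moreover have "\<not> covers b a" "\<not> covers c b" using rks by (simp_all add: covers_def)
    ultimately have V: "{a, b, c} \<subseteq> ?V" "covers a b" "covers b c"
      by (auto simp: suspended_RP2_def)
    then have "a mod 6 < 3" "c mod 6 < 4"
      using rks k by (auto simp: suspended_RP2_verts_def level_width_def)
    then show ?thesis using V rks eq by (auto simp: set_RP2_flags)
  qed
  show ?thesis
  proof (rule thin_magnitude_homology_Z2[OF rk])
    show "card {z. (u, z) \<in> parcs (suspended_RP2 k) \<and> (z, v) \<in> parcs (suspended_RP2 k)} = 2"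
      if "(u, z) \<in> parcs (suspended_RP2 k)" "(z, v) \<in> parcs (suspended_RP2 k)"
        "v div 6 = Suc (Suc (u div 6))" for u z v
      using suspended_RP2_thin[OF k] that by blast
    show "finite C" by (simp add: C_def)
    have "card C = card (set RP2_cocycle)"
      unfolding C_def by (rule card_image) (auto simp: inj_on_def)
    \<comment> \<open>The cocycle has nine pairs. The odd count says that the sum of all edges of
      the order complex of the hemi-octahedron pairs nontrivially with the double cover.\<close>
    then show "odd (card C)" by (simp add: RP2_cocycle_def)
    show "\<exists>w\<in>?F. \<exists>i\<in>{1..<Suc k}. r = delete_nth i w" if r: "r \<in> C" for r
    proof -
      obtain p q where p: "(p, q) \<in> set RP2_cocycle" "r = 0 # p # q # tail"
        using r by (auto simp: C_def)
      obtain a b c where abc: "(a, b, c) \<in> set RP2_flags" "(p, q) = (b, c) \<or> (p, q) = (a, c) \<or> (p, q) = (a, b)"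
        using RP2_cocycle_extend[OF p(1)] by metis
      let ?w = "0 # a # b # c # tail"
      have "r = delete_nth 1 ?w \<or> r = delete_nth 2 ?w \<or> r = delete_nth 3 ?w"
        using abc(2) p(2) by (auto simp: delete_nth_def)
      moreover have "1 \<in> {1..<Suc k}" "2 \<in> {1..<Suc k}" "3 \<in> {1..<Suc k}" using k by auto
      ultimately show ?thesis using tail_in[OF abc(1)] by blast
    qed
    show "even (card {i\<in>{1..<Suc k}. delete_nth i w \<in> C})" if w: "w \<in> ?F" for w
    proof -
      obtain a b c tl where eq: "w = 0 # a # b # c # tl" and abc: "(a, b, c) \<in> set RP2_flags"
        using flag_cases[OF w] by blast
      \<comment> \<open>Deleting rank 1, 2 or 3 leaves one of the three pairs from
        \<open>(a, b, c)\<close>. If the upper part is not \<open>tail\<close>, none of these faces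
        is in \<open>C\<close>; otherwise \<open>RP2_cocycle\<close> makes their number
        even.\<close>
      have del: "delete_nth 1 w \<in> C \<longleftrightarrow> tl = tail \<and> (b, c) \<in> set RP2_cocycle"
        "delete_nth 2 w \<in> C \<longleftrightarrow> tl = tail \<and> (a, c) \<in> set RP2_cocycle"
        "delete_nth 3 w \<in> C \<longleftrightarrow> tl = tail \<and> (a, b) \<in> set RP2_cocycle"
        by (auto simp: delete_nth_def C_def eq)
      \<comment> \<open>A deletion above rank 3 keeps the triangle \<open>c\<close> at position 3,
        whereas members of \<open>C\<close> have there the first entry 24 of \<open>tail\<close>,
        which has rank 4.\<close>
      have "delete_nth i w \<notin> C" if "4 \<le> i" for i
      proof
        assume "delete_nth i w \<in> C"
        then obtain p q where "delete_nth i w = 0 # p # q # tail" by (auto simp: C_def)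
        moreover have "delete_nth i w = 0 # a # b # c # delete_nth (i - 4) tl"
        proof -
          obtain j where "i = Suc (Suc (Suc (Suc j)))"
            using \<open>4 \<le> i\<close> by atomize_elim presburger
          then show ?thesis by (simp add: delete_nth_def eq)
        qed
        ultimately have "c = hd tail" by (metis list.inject list.sel(1))
        also have "hd tail = 24" using k by (simp add: tail_def hd_map upt_conv_Cons del: upt_Suc)
        finally show False using abc by (simp add: set_RP2_flags)
      qed
      then have "i \<in> {1, 2, 3}" if "1 \<le> i" "delete_nth i w \<in> C" for i
        using that by (cases "4 \<le> i") auto
      then have "{i\<in>{1..<Suc k}. delete_nth i w \<in> C} = set (filter (\<lambda>i. delete_nth i w \<in> C) [1, 2, 3])"
        using k by auto
      then have "card {i\<in>{1..<Suc k}. delete_nth i w \<in> C} =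
          length (filter (\<lambda>i. delete_nth i w \<in> C) [1, 2, 3])"
        by (simp only: distinct_card distinct_filter) simp
      then show ?thesis
        using RP2_cocycle[OF abc] by (simp add: del del: One_nat_def)
    qed
  qed
qed

theorem theorem3p5:
  fixes k :: nat
  assumes "odd k" and "k \<ge> 3"
  shows "\<exists>G :: nat pair_pre_digraph. pair_graph G \<and>
           (\<exists>H. subgroup H (magnitude_homology G k (k + 1)) \<and>
                (magnitude_homology G k (k + 1))\<lparr>carrier := H\<rparr> \<cong> integer_mod_group 2)"
  using graded_graph.axioms(1)[OF graded_graph_suspended_RP2, of k]
    magnitude_homology_suspended_RP2[OF assms(2)] by auto

end
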